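(* Let $\alpha$ be a non-zero complex number and let $T=T(t_n,\alpha)$ be a bounded operator. Suppose that (1) there exists $i_0\in\mathbb{Z}$ such that, for integers $n\neq m$, the equality $t_n^2+\frac{1}{t_n^2}=t_m^2+\frac{1}{t_m^2}$ holds only when $m=-(n+i_0)$; and (2) for all $n\in\mathbb{Z}$, $t_n>0$, $t_n\neq\frac{1}{t_{n-1}}$ and $\frac{1}{t_{n-1}}\neq 1$. Then $T$ is irreducible.
   Context: Let $\{e_n\}_{n\in\mathbb{Z}}$ be the standard orthonormal basis of $l^2(\mathbb{Z})$ (complex scalars). For a sequence $\{t_n\}_{n\in\mathbb{Z}}$ of non-zero numbers, let $T_0,T_1$ be the bounded bilateral weighted shifts on $l^2(\mathbb{Z})$ given by $T_0e_n=t_ne_{n+1}$ and $T_1e_n=\frac{1}{t_n}e_{n+1}$. For $\alpha\in\mathbb{C}$ put $X=\alpha I$; it is assumed throughout that $XT_1\neq T_0X$. Define $$T(t_n,\alpha)=\begin{pmatrix}T_0&XT_1-T_0X\\0&T_1\end{pmatrix}=\begin{pmatrix}T_0&\alpha(T_1-T_0)\\0&T_1\end{pmatrix}$$ acting on $l^2(\mathbb{Z})\oplus l^2(\mathbb{Z})$. A bounded operator is irreducible if its only reducing subspaces (closed subspaces $\mathcal{M}$ such that $\mathcal{M}$ and $\mathcal{M}^\perp$ are both invariant) are $\{0\}$ and the whole space. *)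

theory Defs
  imports "HOL-Analysis.Analysis"
begin

section \<open>Complex inner product spaces\<close>

class scaleC =
  fixes scaleC :: "complex \<Rightarrow> 'a \<Rightarrow> 'a" (infixr \<open>*\<^sub>C\<close> 75)

text \<open>
  The underlying real inner product space fixes norm and topology; the inner product is linear
  in its first argument. Positive definiteness is inherited from \<^class>\<open>real_inner\<close>
  through the last axiom.
\<close>

class complex_inner = real_inner + scaleC +
  fixes cinner :: "'a \<Rightarrow> 'a \<Rightarrow> complex"
  assumes scaleC_add_right: "c *\<^sub>C (x + y) = c *\<^sub>C x + c *\<^sub>C y"
    and scaleC_add_left: "(c + d) *\<^sub>C x = c *\<^sub>C x + d *\<^sub>C x"
    and scaleC_scaleC: "c *\<^sub>C d *\<^sub>C x = (c * d) *\<^sub>C x"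
    and scaleC_of_real: "complex_of_real r *\<^sub>C x = r *\<^sub>R x"
    and cinner_add_left: "cinner (x + y) z = cinner x z + cinner y z"
    and cinner_scaleC_left: "cinner (c *\<^sub>C x) y = c * cinner x y"
    and cinner_commute: "cinner x y = cnj (cinner y x)"
    and Re_cinner: "Re (cinner x y) = x \<bullet> y"

instantiation prod :: (complex_inner, complex_inner) complex_inner
begin

definition scaleC_prod_def: "c *\<^sub>C p = (c *\<^sub>C fst p, c *\<^sub>C snd p)"

definition cinner_prod_def: "cinner p q = cinner (fst p) (fst q) + cinner (snd p) (snd q)"

instance
proof
  fix c d :: complex and r :: real and x y z :: "'a \<times> 'b"
  show "c *\<^sub>C (x + y) = c *\<^sub>C x + c *\<^sub>C y"
    by (simp add: scaleC_prod_def scaleC_add_right)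
  show "(c + d) *\<^sub>C x = c *\<^sub>C x + d *\<^sub>C x"
    by (simp add: scaleC_prod_def scaleC_add_left)
  show "c *\<^sub>C d *\<^sub>C x = (c * d) *\<^sub>C x"
    by (simp add: scaleC_prod_def scaleC_scaleC)
  show "complex_of_real r *\<^sub>C x = r *\<^sub>R x"
    by (simp add: scaleC_prod_def scaleC_of_real scaleR_prod_def)
  show "cinner (x + y) z = cinner x z + cinner y z"
    by (simp add: cinner_prod_def cinner_add_left)
  show "cinner (c *\<^sub>C x) y = c * cinner x y"
    by (simp add: cinner_prod_def scaleC_prod_def cinner_scaleC_left distrib_left)
  show "cinner x y = cnj (cinner y x)"
    unfolding cinner_prod_def
    by (metis cinner_commute complex_cnj_add)
  show "Re (cinner x y) = x \<bullet> y"
    by (simp add: cinner_prod_def inner_prod_def Re_cinner)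
qed

end


section \<open>Bounded operators and reducing subspaces\<close>

definition bounded_op :: "('a::complex_inner \<Rightarrow> 'b::complex_inner) \<Rightarrow> bool" where
  "bounded_op A \<longleftrightarrow> bounded_linear A \<and> (\<forall>c x. A (c *\<^sub>C x) = c *\<^sub>C A x)"

definition csubspace :: "'a::complex_inner set \<Rightarrow> bool" where
  "csubspace M \<longleftrightarrow> subspace M \<and> (\<forall>c. \<forall>x\<in>M. c *\<^sub>C x \<in> M)"

definition orth_compl :: "'a::complex_inner set \<Rightarrow> 'a set" where
  "orth_compl M = {y. \<forall>x\<in>M. cinner x y = 0}"

definition reducing_subspace :: "('a::complex_inner \<Rightarrow> 'a) \<Rightarrow> 'a set \<Rightarrow> bool" where
  "reducing_subspace A M \<longleftrightarrow>
     csubspace M \<and> closed M \<and> A ` M \<subseteq> M \<and> A ` orth_compl M \<subseteq> orth_compl M"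

definition irreducible_op :: "('a::complex_inner \<Rightarrow> 'a) \<Rightarrow> bool" where
  "irreducible_op A \<longleftrightarrow> (\<forall>M. reducing_subspace A M \<longrightarrow> M = {0} \<or> M = UNIV)"


section \<open>The Hilbert space of square-summable families\<close>

typedef 'a ell2 = "{f :: 'a \<Rightarrow> complex. (\<lambda>i. (cmod (f i))\<^sup>2) summable_on UNIV}"
  morphisms coord Abs_ell2
  by (rule exI[of _ "\<lambda>_. 0"]) simp

setup_lifting type_definition_ell2

lemma coord_square_summable: "(\<lambda>i. (cmod (coord x i))\<^sup>2) summable_on UNIV"
  using coord[of x] by simp

lemma ell2_eqI: "(\<And>i. coord x i = coord y i) \<Longrightarrow> x = y"
  by (simp add: coord_inject[symmetric] ext)

lemma square_summable_add:
  fixes f g :: "'a \<Rightarrow> complex"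
  assumes "(\<lambda>i. (cmod (f i))\<^sup>2) summable_on UNIV" "(\<lambda>i. (cmod (g i))\<^sup>2) summable_on UNIV"
  shows "(\<lambda>i. (cmod (f i + g i))\<^sup>2) summable_on UNIV"
proof (rule summable_on_comparison_test)
  show "(\<lambda>i. 2 * (cmod (f i))\<^sup>2 + 2 * (cmod (g i))\<^sup>2) summable_on UNIV"
    by (intro summable_on_add summable_on_cmult_right assms)
  fix i
  have "(cmod (f i + g i))\<^sup>2 \<le> (cmod (f i) + cmod (g i))\<^sup>2"
    by (intro power_mono norm_triangle_ineq norm_ge_zero)
  also have "\<dots> \<le> 2 * (cmod (f i))\<^sup>2 + 2 * (cmod (g i))\<^sup>2"
    by (smt (verit) sum_squares_bound power2_sum)
  finally show "(cmod (f i + g i))\<^sup>2 \<le> 2 * (cmod (f i))\<^sup>2 + 2 * (cmod (g i))\<^sup>2" .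
qed simp

lemma square_summable_scale:
  fixes f :: "'a \<Rightarrow> complex"
  assumes "(\<lambda>i. (cmod (f i))\<^sup>2) summable_on UNIV"
  shows "(\<lambda>i. (cmod (c * f i))\<^sup>2) summable_on UNIV"
  by (simp add: norm_mult power_mult_distrib summable_on_cmult_right assms)

lemma coord_product_summable: "(\<lambda>i. coord x i * cnj (coord y i)) summable_on UNIV"
  by (rule abs_summable_summable, rule abs_summable_product)
     (use coord_square_summable[of x] coord_square_summable[of y] in
       \<open>simp_all add: norm_mult power2_eq_square\<close>)

instantiation ell2 :: (type) complex_inner
begin

lift_definition zero_ell2 :: "'a ell2" is "\<lambda>_. 0"
  by simp

lift_definition plus_ell2 :: "'a ell2 \<Rightarrow> 'a ell2 \<Rightarrow> 'a ell2" is "\<lambda>f g i. f i + g i"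
  by (rule square_summable_add)

lift_definition uminus_ell2 :: "'a ell2 \<Rightarrow> 'a ell2" is "\<lambda>f i. - f i"
  by simp

lift_definition minus_ell2 :: "'a ell2 \<Rightarrow> 'a ell2 \<Rightarrow> 'a ell2" is "\<lambda>f g i. f i - g i"
  using square_summable_add[of _ "\<lambda>i. - _ i"] by simp

lift_definition scaleC_ell2 :: "complex \<Rightarrow> 'a ell2 \<Rightarrow> 'a ell2" is "\<lambda>c f i. c * f i"
  by (rule square_summable_scale)

definition scaleR_ell2 :: "real \<Rightarrow> 'a ell2 \<Rightarrow> 'a ell2" where
  "scaleR_ell2 r x = complex_of_real r *\<^sub>C x"

definition cinner_ell2 :: "'a ell2 \<Rightarrow> 'a ell2 \<Rightarrow> complex" where
  "cinner_ell2 x y = (\<Sum>\<^sub>\<infinity>i. coord x i * cnj (coord y i))"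

definition inner_ell2 :: "'a ell2 \<Rightarrow> 'a ell2 \<Rightarrow> real" where
  "inner_ell2 x y = Re (\<Sum>\<^sub>\<infinity>i. coord x i * cnj (coord y i))"

definition norm_ell2 :: "'a ell2 \<Rightarrow> real" where
  "norm_ell2 x = sqrt (\<Sum>\<^sub>\<infinity>i. (cmod (coord x i))\<^sup>2)"

definition sgn_ell2 :: "'a ell2 \<Rightarrow> 'a ell2" where
  "sgn_ell2 x = inverse (norm x) *\<^sub>R x"

definition dist_ell2 :: "'a ell2 \<Rightarrow> 'a ell2 \<Rightarrow> real" where
  "dist_ell2 x y = norm (x - y)"

definition uniformity_ell2 :: "('a ell2 \<times> 'a ell2) filter" where
  "uniformity_ell2 = (INF e\<in>{0<..}. principal {(x, y). dist x y < e})"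

definition open_ell2 :: "'a ell2 set \<Rightarrow> bool" where
  "open_ell2 U \<longleftrightarrow> (\<forall>x\<in>U. \<forall>\<^sub>F (x', y) in uniformity. x' = x \<longrightarrow> y \<in> U)"

instance
proof
  fix c d :: complex and r s :: real and x y z :: "'a ell2" and U :: "'a ell2 set"
  note coords = zero_ell2.rep_eq plus_ell2.rep_eq uminus_ell2.rep_eq minus_ell2.rep_eq
    scaleC_ell2.rep_eq
  have scaleC_right: "c *\<^sub>C (x + y) = c *\<^sub>C x + c *\<^sub>C y" for c and x y :: "'a ell2"
    by (rule ell2_eqI) (simp add: coords algebra_simps)
  have scaleC_left: "(c + d) *\<^sub>C x = c *\<^sub>C x + d *\<^sub>C x" for c d and x :: "'a ell2"
    by (rule ell2_eqI) (simp add: coords algebra_simps)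
  have scaleC_scaleC: "c *\<^sub>C d *\<^sub>C x = (c * d) *\<^sub>C x" for c d and x :: "'a ell2"
    by (rule ell2_eqI) (simp add: coords algebra_simps)
  have cinner_add: "cinner (x + y) z = cinner x z + cinner y z" for x y z :: "'a ell2"
    unfolding cinner_ell2_def
    by (subst infsum_add[symmetric])
       (simp_all add: coord_product_summable coords algebra_simps)
  have cinner_scaleC: "cinner (c *\<^sub>C x) y = c * cinner x y" for c and x y :: "'a ell2"
    unfolding cinner_ell2_def
    by (subst infsum_cmult_right[symmetric])
       (simp_all add: coord_product_summable coords mult.assoc)
  have cinner_comm: "cinner x y = cnj (cinner y x)" for x y :: "'a ell2"
    unfolding cinner_ell2_def by (simp add: infsum_cnj[symmetric] mult.commute)
  have inner_Re: "x \<bullet> y = Re (cinner x y)" for x y :: "'a ell2"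
    by (simp add: inner_ell2_def cinner_ell2_def)
  have inner_self: "x \<bullet> x = (\<Sum>\<^sub>\<infinity>i. (cmod (coord x i))\<^sup>2)" for x :: "'a ell2"
    unfolding inner_ell2_def infsum_Re[OF coord_product_summable[of x x], symmetric]
    by (simp add: complex_mult_cnj cmod_power2)
  show "x + y + z = x + (y + z)" "x + y = y + x" "0 + x = x" "- x + x = 0" "x - y = x + - y"
    by (rule ell2_eqI; simp add: coords)+
  show "r *\<^sub>R (x + y) = r *\<^sub>R x + r *\<^sub>R y" "(r + s) *\<^sub>R x = r *\<^sub>R x + s *\<^sub>R x"
    "r *\<^sub>R s *\<^sub>R x = (r * s) *\<^sub>R x" "1 *\<^sub>R x = x"
    by (simp_all add: scaleR_ell2_def scaleC_right scaleC_left scaleC_scaleC)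
       (rule ell2_eqI, simp add: coords)
  show "dist x y = norm (x - y)" by (rule dist_ell2_def)
  show "sgn x = inverse (norm x) *\<^sub>R x" by (rule sgn_ell2_def)
  show "uniformity = (INF e\<in>{0<..}. principal {(x, y :: 'a ell2). dist x y < e})"
    by (rule uniformity_ell2_def)
  show "open U \<longleftrightarrow> (\<forall>x\<in>U. \<forall>\<^sub>F (x', y) in uniformity. x' = x \<longrightarrow> y \<in> U)"
    by (rule open_ell2_def)
  show "x \<bullet> y = y \<bullet> x"
    unfolding inner_Re by (subst cinner_comm) simp
  show "(x + y) \<bullet> z = x \<bullet> z + y \<bullet> z"
    by (simp add: inner_Re cinner_add)
  show "r *\<^sub>R x \<bullet> y = r * (x \<bullet> y)"
    by (simp add: inner_Re scaleR_ell2_def cinner_scaleC)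
  show "0 \<le> x \<bullet> x"
    by (simp add: inner_self infsum_nonneg)
  show "x \<bullet> x = 0 \<longleftrightarrow> x = 0"
  proof
    assume "x \<bullet> x = 0"
    then have "(cmod (coord x i))\<^sup>2 = 0" for i
      by (intro nonneg_infsum_le_0D[where A = UNIV])
         (auto simp: inner_self coord_square_summable)
    then show "x = 0"
      by (intro ell2_eqI) (simp add: coords)
  qed (simp add: inner_self coords)
  show "norm x = sqrt (x \<bullet> x)"
    by (simp add: norm_ell2_def inner_self)
  show "c *\<^sub>C (x + y) = c *\<^sub>C x + c *\<^sub>C y" by (rule scaleC_right)
  show "(c + d) *\<^sub>C x = c *\<^sub>C x + d *\<^sub>C x" by (rule scaleC_left)
  show "c *\<^sub>C d *\<^sub>C x = (c * d) *\<^sub>C x" by (rule scaleC_scaleC)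
  show "complex_of_real r *\<^sub>C x = r *\<^sub>R x" by (simp add: scaleR_ell2_def)
  show "cinner (x + y) z = cinner x z + cinner y z" by (rule cinner_add)
  show "cinner (c *\<^sub>C x) y = c * cinner x y" by (rule cinner_scaleC)
  show "cinner x y = cnj (cinner y x)" by (rule cinner_comm)
  show "Re (cinner x y) = x \<bullet> y" by (simp add: inner_Re)
qed

end

instance ell2 :: (type) complete_space
proof
  fix X :: "nat \<Rightarrow> 'a ell2"
  assume X: "Cauchy X"
  have norm_sq: "(norm x)\<^sup>2 = (\<Sum>\<^sub>\<infinity>i. (cmod (coord x i))\<^sup>2)" for x :: "'a ell2"
    by (simp add: norm_ell2_def infsum_nonneg)
  have sum_le: "(\<Sum>i\<in>F. (cmod (coord x i))\<^sup>2) \<le> (norm x)\<^sup>2" if "finite F" for F and x :: "'a ell2"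
    unfolding norm_sq by (rule finite_sum_le_infsum) (auto simp: coord_square_summable that)
  have coord_le: "cmod (coord x i) \<le> norm x" for i and x :: "'a ell2"
    by (rule power2_le_imp_le[OF _ norm_ge_zero]) (use sum_le[of "{i}" x] in simp)
  have "Cauchy (\<lambda>n. coord (X n) i)" for i
  proof (rule metric_CauchyI)
    fix e :: real assume "e > 0"
    then obtain N where N: "\<And>m n. m \<ge> N \<Longrightarrow> n \<ge> N \<Longrightarrow> dist (X m) (X n) < e"
      using metric_CauchyD[OF X] by blast
    have "dist (coord (X m) i) (coord (X n) i) < e" if "m \<ge> N" "n \<ge> N" for m n
      using coord_le[of "X m - X n" i] N[OF that] by (simp add: dist_norm minus_ell2.rep_eq)
    then show "\<exists>M. \<forall>m\<ge>M. \<forall>n\<ge>M. dist (coord (X m) i) (coord (X n) i) < e" by blast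
  qed
  then have "\<exists>l. (\<lambda>n. coord (X n) i) \<longlonglongrightarrow> l" for i
    using Cauchy_convergent convergent_def by blast
  then obtain L where L: "\<And>i. (\<lambda>n. coord (X n) i) \<longlonglongrightarrow> L i" by metis
  have tail: "(\<Sum>i\<in>F. (cmod (L i - coord (X n) i))\<^sup>2) \<le> e\<^sup>2"
    if F: "finite F" and e: "e > 0" and n: "n \<ge> N"
      and N: "\<And>m n. m \<ge> N \<Longrightarrow> n \<ge> N \<Longrightarrow> dist (X m) (X n) < e" for F e n N
  proof (rule LIMSEQ_le_const2)
    show "(\<lambda>m. \<Sum>i\<in>F. (cmod (coord (X m) i - coord (X n) i))\<^sup>2)
            \<longlonglongrightarrow> (\<Sum>i\<in>F. (cmod (L i - coord (X n) i))\<^sup>2)"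
      by (intro tendsto_intros L)
    have "(\<Sum>i\<in>F. (cmod (coord (X m) i - coord (X n) i))\<^sup>2) \<le> e\<^sup>2" if "m \<ge> N" for m
    proof -
      have "(\<Sum>i\<in>F. (cmod (coord (X m) i - coord (X n) i))\<^sup>2) \<le> (norm (X m - X n))\<^sup>2"
        using sum_le[OF F, of "X m - X n"] by (simp add: minus_ell2.rep_eq)
      also have "\<dots> \<le> e\<^sup>2"
        using N[OF that n] by (intro power_mono) (simp_all add: dist_norm)
      finally show ?thesis .
    qed
    then show "\<exists>M. \<forall>m\<ge>M. (\<Sum>i\<in>F. (cmod (coord (X m) i - coord (X n) i))\<^sup>2) \<le> e\<^sup>2" by blast
  qed
  have diff_summable: "(\<lambda>i. (cmod (L i - coord (X n) i))\<^sup>2) summable_on UNIV"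
    if "e > 0" "n \<ge> N" "\<And>m n. m \<ge> N \<Longrightarrow> n \<ge> N \<Longrightarrow> dist (X m) (X n) < e" for e n N
    by (rule nonneg_bdd_above_summable_on) (auto intro!: bdd_aboveI[of _ "e\<^sup>2"] tail that)
  obtain N1 where N1: "\<And>m n. m \<ge> N1 \<Longrightarrow> n \<ge> N1 \<Longrightarrow> dist (X m) (X n) < 1"
    using metric_CauchyD[OF X, of 1] by auto
  have "(\<lambda>i. (cmod ((L i - coord (X N1) i) + coord (X N1) i))\<^sup>2) summable_on UNIV"
    by (rule square_summable_add[OF diff_summable[OF _ _ N1] coord_square_summable]) auto
  then have "L \<in> {f. (\<lambda>i. (cmod (f i))\<^sup>2) summable_on UNIV}" by simp
  then have coord_L: "coord (Abs_ell2 L) = L" by (rule Abs_ell2_inverse)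
  have "X \<longlonglongrightarrow> Abs_ell2 L"
  proof (rule metric_LIMSEQ_I)
    fix e :: real assume "e > 0"
    then have e: "e / 2 > 0" by simp
    then obtain N where N: "\<And>m n. m \<ge> N \<Longrightarrow> n \<ge> N \<Longrightarrow> dist (X m) (X n) < e / 2"
      using metric_CauchyD[OF X] by blast
    have "dist (X n) (Abs_ell2 L) < e" if n: "n \<ge> N" for n
    proof -
      have "(norm (Abs_ell2 L - X n))\<^sup>2 \<le> (e / 2)\<^sup>2"
        unfolding norm_sq minus_ell2.rep_eq coord_L
        by (rule infsum_le_finite_sums[OF diff_summable[OF e n N]]) (use tail[OF _ e n N] in auto)
      then have "norm (Abs_ell2 L - X n) \<le> e / 2"
        using e by (auto intro: power2_le_imp_le)
      then show ?thesis
        using e by (simp add: dist_norm norm_minus_commute)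
    qed
    then show "\<exists>N. \<forall>n\<ge>N. dist (X n) (Abs_ell2 L) < e" by blast
  qed
  then show "convergent X" by (rule convergentI)
qed

lift_definition basis_vec :: "'a \<Rightarrow> 'a ell2" is "\<lambda>n i. if i = n then 1 else 0"
proof -
  fix n :: 'a
  have "(\<lambda>i. (cmod (if i = n then 1 else 0))\<^sup>2) summable_on {n}" by simp
  then show "(\<lambda>i. (cmod (if i = n then 1 else 0))\<^sup>2) summable_on UNIV"
    by (rule summable_on_cong_neutral[THEN iffD1, rotated -1]) auto
qed


section \<open>Weighted shifts and the operator matrix\<close>

text \<open>
  Since the basis vectors span a dense subspace, a weight sequence determines at most one bounded
  operator satisfying this predicate; none satisfies it when the weights are unbounded.
\<close>

definition bilateral_weighted_shift :: "(int \<Rightarrow> complex) \<Rightarrow> (int ell2 \<Rightarrow> int ell2) \<Rightarrow> bool" where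
  "bilateral_weighted_shift w A \<longleftrightarrow>
     bounded_op A \<and> (\<forall>n. A (basis_vec n) = w n *\<^sub>C basis_vec (n + 1))"

definition upper_triangular_op ::
  "('a \<Rightarrow> 'a::plus) \<Rightarrow> ('b \<Rightarrow> 'a) \<Rightarrow> ('b \<Rightarrow> 'b) \<Rightarrow> 'a \<times> 'b \<Rightarrow> 'a \<times> 'b" where
  "upper_triangular_op A B D = (\<lambda>(x, y). (A x + B y, D y))"

definition T_op ::
  "complex \<Rightarrow> (int ell2 \<Rightarrow> int ell2) \<Rightarrow> (int ell2 \<Rightarrow> int ell2) \<Rightarrow>
     int ell2 \<times> int ell2 \<Rightarrow> int ell2 \<times> int ell2" where
  "T_op \<alpha> T0 T1 = (let X = (\<lambda>x. \<alpha> *\<^sub>C x)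
     in upper_triangular_op T0 (\<lambda>y. X (T1 y) - T0 (X y)) T1)"

end

theory Submission
  imports Defs
begin

text \<open>
  In terms of the orthonormal basis \<open>(e\<^sub>n, 0), (0, e\<^sub>n)\<close>, the operator is a bilateral weighted
  shift whose weights are the upper triangular blocks \<open>W\<^sub>n\<close> with rows \<open>(t\<^sub>n, \<alpha> (1/t\<^sub>n - t\<^sub>n))\<close> and
  \<open>(0, 1/t\<^sub>n)\<close>; they have determinant 1. The orthogonal projection \<open>E\<close> onto a reducing subspace
  commutes with the operator and is self-adjoint. For its 2-by-2 blocks \<open>E(i, j)\<close> this says
  \<open>E(i+1, j+1) W\<^sub>j = W\<^sub>i E(i, j)\<close> and \<open>E(j, i) = E(i, j)*\<close>, and together these give the intertwining
  relations \<open>E(i, j) (W\<^sub>j* W\<^sub>j) = (W\<^sub>i* W\<^sub>i) E(i, j)\<close> and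
  \<open>E(i+1, j+1) (W\<^sub>j W\<^sub>j*) = (W\<^sub>i W\<^sub>i*) E(i+1, j+1)\<close>.

  The matrix \<open>W\<^sub>n* W\<^sub>n\<close> has determinant 1 and a trace that is an injective function of
  \<open>t\<^sub>n\<^sup>2 + 1/t\<^sub>n\<^sup>2\<close>. By Cayley--Hamilton an intertwiner of two such matrices with different traces
  vanishes (lemma \<open>intertwiner_eq_0\<close>), so an off-diagonal block can be non-zero only if
  \<open>j = -(i + i\<^sub>0)\<close>. Since \<open>E(i, j)\<close> vanishes as soon as \<open>E(i+1, j+1)\<close> does, and \<open>(i, j)\<close> and
  \<open>(i + 1, j + 1)\<close> cannot both lie on that antidiagonal, \<open>E\<close> is block diagonal.

  A diagonal block \<open>E(n, n)\<close> commutes with \<open>W\<^sub>n* W\<^sub>n\<close> and with \<open>V V*\<close>, where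
  \<open>V\<close> is the block before \<open>W\<^sub>n\<close>. Under the second assumption on the weights these two do not commute with each other (lemma
  \<open>weight_block_noncommute\<close>), so \<open>E(n, n)\<close> is a scalar (lemma \<open>commutant_scalar\<close>); the shift relation
  makes this scalar independent of \<open>n\<close>. Hence \<open>E\<close> is a multiple of the identity, and its range
  is zero or everything.
\<close>

section \<open>Orthogonal projections\<close>

lemma cinner_add_right: "cinner z (x + y) = cinner z x + cinner z y"
  by (metis cinner_add_left cinner_commute complex_cnj_add)

lemma cinner_scaleC_right: "cinner x (c *\<^sub>C y) = cnj c * cinner x y"
  by (metis cinner_scaleC_left cinner_commute complex_cnj_mult)

lemma cinner_zero_left [simp]: "cinner 0 x = 0"
  using cinner_add_left[of 0 0 x] by simp

lemma cinner_zero_right [simp]: "cinner x 0 = 0"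
  using cinner_add_right[of x 0 0] by simp

lemma cinner_eq_0_commute: "cinner x y = 0 \<longleftrightarrow> cinner y x = 0"
  by (subst cinner_commute) simp

lemma cinner_diff_left: "cinner (x - y) z = cinner x z - cinner y z"
  using cinner_add_left[of "x - y" y z] by simp

lemma cinner_diff_right: "cinner z (x - y) = cinner z x - cinner z y"
  using cinner_add_right[of z "x - y" y] by simp

lemma cinner_eq_inner: "cinner x y = Complex (x \<bullet> y) (x \<bullet> (\<i> *\<^sub>C y))"
  by (simp add: complex_eq_iff cinner_scaleC_right flip: Re_cinner)

lemma continuous_on_cinner_left:
  assumes "continuous_on S f"
  shows "continuous_on S (\<lambda>x. cinner (f x) y)"
  unfolding cinner_eq_inner Complex_eq by (intro continuous_intros assms)

lemma cinner_self_eq_0: "cinner x x = 0 \<longleftrightarrow> x = 0"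
  by (metis Re_cinner cinner_zero_left inner_eq_zero_iff zero_complex.simps(1))

text \<open>
  A sequence in \<open>M\<close> whose distances to \<open>x\<close> tend to the infimum is Cauchy by the parallelogram law,
  and its limit attains the infimum.
\<close>

lemma ex_nearest_point:
  fixes M :: "'a::{real_inner,complete_space} set"
  assumes "subspace M" "closed M"
  obtains m where "m \<in> M" "\<And>y. y \<in> M \<Longrightarrow> dist x m \<le> dist x y"
proof -
  define d where "d = infdist x M"
  have ne: "M \<noteq> {}" using subspace_0[OF assms(1)] by blast
  have d0: "0 \<le> d" by (simp add: d_def infdist_nonneg)
  have d_le: "d \<le> dist x y" if "y \<in> M" for y
    using that by (simp add: d_def infdist_le)
  have "\<exists>y\<in>M. dist x y < d + 1 / real (Suc n)" for n
  proof (rule ccontr)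
    assume "\<not> ?thesis"
    then have "d + 1 / real (Suc n) \<le> d"
      unfolding d_def by (subst (2) infdist_notempty[OF ne], intro cINF_greatest ne) force
    then show False by (simp add: field_simps)
  qed
  then obtain Y where Y: "\<And>n. Y n \<in> M" "\<And>n. dist x (Y n) < d + 1 / real (Suc n)"
    by metis
  have Ylim: "(\<lambda>n. dist x (Y n)) \<longlonglongrightarrow> d"
  proof (rule tendsto_sandwich[of "\<lambda>_. d"])
    show "(\<lambda>n. d + 1 / real (Suc n)) \<longlonglongrightarrow> d"
      using LIMSEQ_inverse_real_of_nat_add[of d] by (simp add: inverse_eq_divide)
    show "\<forall>\<^sub>F n in sequentially. dist x (Y n) \<le> d + 1 / real (Suc n)"
      using Y(2) by (auto intro: less_imp_le always_eventually)
  qed (auto simp: d_le Y)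
  \<comment> \<open>The midpoint of two points of \<open>M\<close> is in \<open>M\<close>, so it is at distance at least \<open>d\<close> from \<open>x\<close>;
      the parallelogram law then bounds their distance from each other.\<close>
  have key: "(dist (Y m) (Y n))\<^sup>2 \<le> 2 * (dist x (Y m))\<^sup>2 + 2 * (dist x (Y n))\<^sup>2 - 4 * d\<^sup>2" for m n
  proof -
    let ?z = "(1/2) *\<^sub>R (Y m + Y n)"
    have "?z \<in> M" by (intro subspace_scale subspace_add assms Y)
    then have "d\<^sup>2 \<le> (dist x ?z)\<^sup>2" by (intro power_mono d_le d0)
    moreover have "(dist (Y m) (Y n))\<^sup>2 + 4 * (dist x ?z)\<^sup>2
        = 2 * (dist x (Y m))\<^sup>2 + 2 * (dist x (Y n))\<^sup>2"
      by (simp add: dist_norm power2_norm_eq_inner algebra_simps inner_commute)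
    ultimately show ?thesis by linarith
  qed
  have "Cauchy Y"
  proof (rule metric_CauchyI)
    fix e :: real assume e: "e > 0"
    have "(\<lambda>n. (dist x (Y n))\<^sup>2) \<longlonglongrightarrow> d\<^sup>2" by (intro tendsto_intros Ylim)
    moreover have "d\<^sup>2 < d\<^sup>2 + e\<^sup>2 / 4" using e by simp
    ultimately have "\<forall>\<^sub>F n in sequentially. (dist x (Y n))\<^sup>2 < d\<^sup>2 + e\<^sup>2 / 4"
      by (rule order_tendstoD)
    then obtain N where N: "\<And>n. n \<ge> N \<Longrightarrow> (dist x (Y n))\<^sup>2 < d\<^sup>2 + e\<^sup>2 / 4"
      by (auto simp: eventually_sequentially)
    have "dist (Y m) (Y n) < e" if "m \<ge> N" "n \<ge> N" for m n
    proof -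
      have "(dist (Y m) (Y n))\<^sup>2 < e\<^sup>2" using key[of m n] N[OF that(1)] N[OF that(2)] by linarith
      then show ?thesis using e by (meson less_imp_le power_less_imp_less_base)
    qed
    then show "\<exists>N. \<forall>m\<ge>N. \<forall>n\<ge>N. dist (Y m) (Y n) < e" by blast
  qed
  then obtain m where m: "Y \<longlonglongrightarrow> m"
    using Cauchy_convergent convergent_def by blast
  have "m \<in> M" using closed_sequentially[OF assms(2) _ m] Y by blast
  moreover have "dist x m = d"
    by (rule LIMSEQ_unique[OF _ Ylim]) (intro tendsto_intros m)
  ultimately show ?thesis using that d_le by simp
qed

text \<open>
  The nearest point of \<open>M\<close> works: if the residual were not orthogonal to \<open>y\<close>, a step in the
  direction of \<open>y\<close> would decrease the distance. This gives real orthogonality, which is complex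
  orthogonality because \<open>M\<close> is closed under multiplication by \<open>\<i>\<close>.
\<close>

lemma orthogonal_decomposition:
  fixes M :: "'a::{complex_inner,complete_space} set"
  assumes "csubspace M" "closed M"
  obtains m where "m \<in> M" "x - m \<in> orth_compl M"
proof -
  have sub: "subspace M" using assms(1) by (simp add: csubspace_def)
  obtain m where m: "m \<in> M" "\<And>y. y \<in> M \<Longrightarrow> dist x m \<le> dist x y"
    using ex_nearest_point[OF sub assms(2)] by blast
  have real: "(x - m) \<bullet> y = 0" if y: "y \<in> M" for y
  proof (cases "y = 0")
    case False
    \<comment> \<open>the step along \<open>y\<close> that minimizes the distance\<close>
    define l where "l = ((x - m) \<bullet> y) / (y \<bullet> y)"
    have yy: "y \<bullet> y > 0" using False by simp
    have "m + l *\<^sub>R y \<in> M" by (intro subspace_add subspace_scale sub m y)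
    then have "(dist x m)\<^sup>2 \<le> (dist x (m + l *\<^sub>R y))\<^sup>2" by (intro power_mono m) auto
    also have "\<dots> = (dist x m)\<^sup>2 - 2 * l * ((x - m) \<bullet> y) + l * l * (y \<bullet> y)"
      by (simp add: dist_norm power2_norm_eq_inner algebra_simps inner_commute)
    also have "\<dots> = (dist x m)\<^sup>2 - ((x - m) \<bullet> y)\<^sup>2 / (y \<bullet> y)"
      using False by (simp add: l_def power2_eq_square field_simps)
    finally have "((x - m) \<bullet> y)\<^sup>2 / (y \<bullet> y) \<le> 0" by simp
    then have "((x - m) \<bullet> y)\<^sup>2 \<le> 0" using yy by (simp add: divide_le_0_iff)
    then show ?thesis by simp
  qed simp
  have "cinner (x - m) y = 0" if y: "y \<in> M" for y
  proof -
    have "\<i> *\<^sub>C y \<in> M" using y assms(1) unfolding csubspace_def by blast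
    then show ?thesis unfolding cinner_eq_inner using real y by (simp add: zero_complex.code)
  qed
  then have "x - m \<in> orth_compl M"
    by (simp add: orth_compl_def cinner_eq_0_commute[of _ "x - m"])
  with m that show ?thesis by blast
qed

lemma csubspace_orth_compl: "csubspace (orth_compl M)"
  by (auto simp: csubspace_def orth_compl_def subspace_def cinner_add_right cinner_scaleC_right
      simp flip: scaleC_of_real)

text \<open>
  The decomposition along \<open>M\<close> and its complement is unique, and \<open>A\<close> respects both summands; this
  yields linearity of the projection and its commuting with \<open>A\<close>.
\<close>

lemma reducing_subspace_projection:
  fixes M :: "'a::{complex_inner,complete_space} set"
  assumes red: "reducing_subspace A M" and A: "bounded_op A"
  obtains E where "\<And>x. E x \<in> M" "\<And>x. x - E x \<in> orth_compl M"
    "\<And>x y. E (x + y) = E x + E y" "\<And>c x. E (c *\<^sub>C x) = c *\<^sub>C E x"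
    "\<And>x. E (A x) = A (E x)" "\<And>x y. cinner (E x) y = cinner x (E y)"
proof -
  have M: "csubspace M" "closed M" and AM: "\<And>x. x \<in> M \<Longrightarrow> A x \<in> M"
    and AO: "\<And>x. x \<in> orth_compl M \<Longrightarrow> A x \<in> orth_compl M"
    using red by (auto simp: reducing_subspace_def)
  have sM: "subspace M" and sO: "subspace (orth_compl M)"
    using M(1) csubspace_orth_compl by (auto simp: csubspace_def)
  have lin: "linear A" and AC: "\<And>c x. A (c *\<^sub>C x) = c *\<^sub>C A x"
    using A by (auto simp: bounded_op_def bounded_linear.linear)
  obtain E where EM: "\<And>x. E x \<in> M" and EO: "\<And>x. x - E x \<in> orth_compl M"
  proof -
    have "\<exists>m. m \<in> M \<and> x - m \<in> orth_compl M" for x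
      using orthogonal_decomposition[OF M] by blast
    then show ?thesis using that by metis
  qed
  have uniq: "E x = y" if "y \<in> M" "x - y \<in> orth_compl M" for x y
  proof -
    have "E x - y \<in> M" using sM EM that by (simp add: subspace_diff)
    moreover have "(x - y) - (x - E x) \<in> orth_compl M"
      by (rule subspace_diff[OF sO that(2) EO])
    then have "E x - y \<in> orth_compl M" by simp
    ultimately have "cinner (E x - y) (E x - y) = 0" unfolding orth_compl_def by blast
    then show ?thesis by (simp add: cinner_self_eq_0)
  qed
  have sc: "c *\<^sub>C (x - y) = c *\<^sub>C x - c *\<^sub>C y" for c and x y :: 'a
    using scaleC_add_right[of c "x - y" y] by simp
  show thesis
  proof (rule that[of E, OF EM EO])
    show "E (x + y) = E x + E y" for x y
      using subspace_add[OF sO EO[of x] EO[of y]]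
      by (intro uniq subspace_add sM EM) (simp add: algebra_simps)
    show "E (c *\<^sub>C x) = c *\<^sub>C E x" for c x
      using EO[of x] M(1) csubspace_orth_compl[of M] EM[of x]
      by (intro uniq) (auto simp: csubspace_def simp flip: sc)
    show "E (A x) = A (E x)" for x
      using AO[OF EO[of x]] by (intro uniq AM EM) (simp add: linear_diff[OF lin])
    show "cinner (E x) y = cinner x (E y)" for x y
    proof -
      have "cinner (E x) (y - E y) = 0" using EO[of y] EM[of x] by (simp add: orth_compl_def)
      moreover have "cinner (E y) (x - E x) = 0" using EO[of x] EM[of y] by (simp add: orth_compl_def)
      then have "cinner (x - E x) (E y) = 0" by (simp add: cinner_eq_0_commute)
      ultimately show ?thesis by (simp add: cinner_diff_left cinner_diff_right)
    qed
  qed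
qed

section \<open>Two-by-two matrices\<close>

definition adj :: "complex^'n^'m \<Rightarrow> complex^'m^'n" where
  "adj A = (\<chi> i j. cnj (A $ j $ i))"

lemma adj_mult: "adj (A ** B) = adj B ** adj A"
  by (simp add: adj_def matrix_matrix_mult_def vec_eq_iff mult.commute)

lemma det_adj_2: "det (adj A) = cnj (det A)" for A :: "complex^2^2"
  by (simp add: det_2 adj_def mult.commute)

lemma Cayley_Hamilton_2:
  fixes A :: "'a::comm_ring_1^2^2"
  shows "A ** A = mat (trace A) ** A - mat (det A)"
  by (simp add: vec_eq_iff forall_2 matrix_matrix_mult_def sum_2 mat_def trace_def det_2 algebra_simps)

lemma mat_mult_eq: "mat c ** A = (\<chi> i j. c * A $ i $ j)" for A :: "'a::comm_semiring_1^'n^'m"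
  by (simp add: vec_eq_iff matrix_matrix_mult_def mat_def mult_delta_left)

lemma mult_mat_eq: "A ** mat c = mat c ** A" for A :: "'a::comm_semiring_1^'n^'m"
  by (simp add: mat_mult_eq)
     (simp add: vec_eq_iff matrix_matrix_mult_def mat_def mult_delta_right mult.commute)

lemma matrix_diff_ldistrib: "A ** (B - C) = A ** B - A ** C" for A :: "'a::ring_1^'n^'m"
  by (simp add: vec_eq_iff matrix_matrix_mult_def right_diff_distrib sum_subtractf)

lemma matrix_diff_rdistrib: "(B - C) ** A = B ** A - C ** A" for A :: "'a::ring_1^'n^'m"
  by (simp add: vec_eq_iff matrix_matrix_mult_def left_diff_distrib sum_subtractf)

text \<open>
  Intertwining \<open>A\<close> and \<open>B\<close> entails intertwining \<open>A\<^sup>2\<close> and \<open>B\<^sup>2\<close>. When the determinants agree,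
  Cayley--Hamilton reduces the latter to \<open>tr A (E A) = tr B (E A)\<close>.
\<close>

lemma intertwiner_eq_0:
  fixes A B E :: "'a::field^2^2"
  assumes "E ** A = B ** E" "det A = det B" "det A \<noteq> 0" "trace A \<noteq> trace B"
  shows "E = 0"
proof -
  have "mat (trace A) ** (E ** A) - mat (det A) ** E = E ** (A ** A)"
    by (simp add: Cayley_Hamilton_2[of A] matrix_diff_ldistrib matrix_mul_assoc mult_mat_eq)
  also have "\<dots> = (B ** B) ** E" by (metis assms(1) matrix_mul_assoc)
  also have "\<dots> = mat (trace B) ** (E ** A) - mat (det A) ** E"
    by (simp add: Cayley_Hamilton_2[of B] matrix_diff_rdistrib assms flip: matrix_mul_assoc)
  finally have "mat (trace A) ** (E ** A) = mat (trace B) ** (E ** A)" by simp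
  then have "E ** A = 0" using assms(4) by (simp add: mat_mult_eq vec_eq_iff)
  moreover obtain A' where "A ** A' = mat 1"
    using assms(3) invertible_det_nz[of A] by (auto simp: invertible_def)
  ultimately show ?thesis
    by (metis matrix_mul_assoc matrix_mul_rid times0_left)
qed

text \<open>
  Modulo scalars, a matrix is described by the three numbers \<open>X\<^sub>1\<^sub>2\<close>, \<open>X\<^sub>2\<^sub>1\<close>, \<open>X\<^sub>1\<^sub>1 - X\<^sub>2\<^sub>2\<close>; the
  equations say that the vectors belonging to \<open>X\<close> and \<open>Y\<close> are parallel.
\<close>

lemma commute_2_iff:
  fixes X Y :: "'a::comm_ring_1^2^2"
  shows "X ** Y = Y ** X \<longleftrightarrow> X$1$2 * Y$2$1 = Y$1$2 * X$2$1 \<and>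
      (X$1$1 - X$2$2) * Y$1$2 = (Y$1$1 - Y$2$2) * X$1$2 \<and>
      (X$1$1 - X$2$2) * Y$2$1 = (Y$1$1 - Y$2$2) * X$2$1"
proof -
  have "X ** Y = Y ** X \<longleftrightarrow>
      (X ** Y)$1$1 - (Y ** X)$1$1 = 0 \<and> (X ** Y)$1$2 - (Y ** X)$1$2 = 0 \<and>
      (Y ** X)$2$1 - (X ** Y)$2$1 = 0 \<and> (X ** Y)$2$2 - (Y ** X)$2$2 = 0"
    by (auto simp: vec_eq_iff forall_2)
  also have "(X ** Y)$1$1 - (Y ** X)$1$1 = X$1$2 * Y$2$1 - Y$1$2 * X$2$1"
    by (simp add: matrix_matrix_mult_def sum_2 algebra_simps)
  also have "(X ** Y)$2$2 - (Y ** X)$2$2 = - (X$1$2 * Y$2$1 - Y$1$2 * X$2$1)"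
    by (simp add: matrix_matrix_mult_def sum_2 algebra_simps)
  also have "(X ** Y)$1$2 - (Y ** X)$1$2
      = (X$1$1 - X$2$2) * Y$1$2 - (Y$1$1 - Y$2$2) * X$1$2"
    by (simp add: matrix_matrix_mult_def sum_2 algebra_simps)
  also have "(Y ** X)$2$1 - (X ** Y)$2$1
      = (X$1$1 - X$2$2) * Y$2$1 - (Y$1$1 - Y$2$2) * X$2$1"
    by (simp add: matrix_matrix_mult_def sum_2 algebra_simps)
  finally show ?thesis by auto
qed

text \<open>
  If \<open>E\<close> were not scalar, its vector in the sense of \<open>commute_2_iff\<close> would be non-zero and those of
  \<open>A\<close> and \<open>B\<close>, being parallel to it, would be parallel to each other.
\<close>

lemma commutant_scalar:
  fixes A B E :: "'a::field^2^2"
  assumes EA: "E ** A = A ** E" and EB: "E ** B = B ** E" and AB: "A ** B \<noteq> B ** A"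
  obtains c where "E = mat c"
proof -
  have "E$1$2 = 0 \<and> E$2$1 = 0 \<and> E$1$1 - E$2$2 = 0"
  proof (rule ccontr)
    define b c d where "b = E$1$2" and "c = E$2$1" and "d = E$1$1 - E$2$2"
    assume "\<not> ?thesis"
    then have nz: "b \<noteq> 0 \<or> c \<noteq> 0 \<or> d \<noteq> 0" by (simp add: b_def c_def d_def)
    have 1: "b * A$2$1 = A$1$2 * c" "d * A$1$2 = (A$1$1 - A$2$2) * b" "d * A$2$1 = (A$1$1 - A$2$2) * c"
      using EA unfolding commute_2_iff b_def c_def d_def by blast+
    have 2: "b * B$2$1 = B$1$2 * c" "d * B$1$2 = (B$1$1 - B$2$2) * b" "d * B$2$1 = (B$1$1 - B$2$2) * c"
      using EB unfolding commute_2_iff b_def c_def d_def by blast+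
    have "x * (A$1$2 * B$2$1) = x * (B$1$2 * A$2$1)" if "x = b \<or> x = c \<or> x = d" for x
      using that 1 2 by (elim disjE; hypsubst; algebra)
    moreover have "x * ((A$1$1 - A$2$2) * B$1$2) = x * ((B$1$1 - B$2$2) * A$1$2)"
      if "x = b \<or> x = c \<or> x = d" for x
      using that 1 2 by (elim disjE; hypsubst; algebra)
    moreover have "x * ((A$1$1 - A$2$2) * B$2$1) = x * ((B$1$1 - B$2$2) * A$2$1)"
      if "x = b \<or> x = c \<or> x = d" for x
      using that 1 2 by (elim disjE; hypsubst; algebra)
    ultimately show False
      using nz AB unfolding commute_2_iff by (metis mult_left_cancel)
  qed
  then have "E = mat (E$1$1)"
    by (simp add: vec_eq_iff forall_2 mat_def)
  then show ?thesis by (rule that)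
qed


section \<open>Block weighted shifts\<close>

lemma cinner_basis_vec: "cinner x (basis_vec n) = coord x n"
proof -
  have "cinner x (basis_vec n) = (\<Sum>\<^sub>\<infinity>i\<in>{n}. coord x i)"
    unfolding cinner_ell2_def by (rule infsum_cong_neutral) (auto simp: basis_vec.rep_eq)
  then show ?thesis by simp
qed

definition std_vec :: "'i \<Rightarrow> 2 \<Rightarrow> 'i ell2 \<times> 'i ell2" where
  "std_vec n r = (if r = 1 then (basis_vec n, 0) else (0, basis_vec n))"

lemma cinner_std_vec: "cinner v (std_vec n r) = coord (if r = 1 then fst v else snd v) n"
  by (simp add: std_vec_def cinner_prod_def cinner_basis_vec)

lemma cinner_std_vec_std_vec:
  "cinner (std_vec m k) (std_vec n r) = (if m = n \<and> k = r then 1 else 0)"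
  using exhaust_2[of k] exhaust_2[of r]
  by (auto simp: cinner_std_vec) (auto simp: std_vec_def basis_vec.rep_eq zero_ell2.rep_eq)

lemma eq_0_if_orthogonal_std_vec:
  assumes "\<And>n r. cinner v (std_vec n r) = 0"
  shows "v = 0"
proof -
  have "coord (fst v) n = 0 \<and> coord (snd v) n = 0" for n
    using assms[of n 1] assms[of n 2] by (simp add: cinner_std_vec)
  then show ?thesis by (auto simp: prod_eq_iff zero_ell2.rep_eq intro!: ell2_eqI)
qed

text \<open>
  The finite linear combinations of the basis vectors are dense: a vector orthogonal to all of them
  is zero, so the part of any vector orthogonal to \<open>M\<close> vanishes.
\<close>

lemma closed_csubspace_eq_UNIV:
  assumes "csubspace M" "closed M" "\<And>n r. std_vec n r \<in> M"
  shows "M = UNIV"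
proof -
  have "x \<in> M" for x
  proof -
    obtain m where m: "m \<in> M" "x - m \<in> orth_compl M"
      using orthogonal_decomposition[OF assms(1,2)] by blast
    have "cinner (x - m) (std_vec n r) = 0" for n r
      using m(2) assms(3)[of n r] by (simp add: orth_compl_def cinner_eq_0_commute[of "x - m"])
    then have "x - m = 0" by (rule eq_0_if_orthogonal_std_vec)
    with m(1) show ?thesis by simp
  qed
  then show ?thesis by blast
qed

definition block_shift ::
  "(int \<Rightarrow> complex^2^2) \<Rightarrow> (int ell2 \<times> int ell2 \<Rightarrow> int ell2 \<times> int ell2) \<Rightarrow> bool" where
  "block_shift W A \<longleftrightarrow> bounded_op A \<and>
     (\<forall>n k. A (std_vec n k) = W n $ 1 $ k *\<^sub>C std_vec (n + 1) 1 + W n $ 2 $ k *\<^sub>C std_vec (n + 1) 2)"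

text \<open>
  The definition prescribes \<open>A\<close> on basis vectors only; since both sides are continuous and linear
  in \<open>v\<close>, the coordinate formula extends to all vectors.
\<close>

lemma block_shift_coord:
  assumes "block_shift W A"
  shows "cinner (A v) (std_vec (n + 1) r) = (\<Sum>k\<in>UNIV. W n $ r $ k * cinner v (std_vec n k))"
proof -
  define M where "M = {v. cinner (A v) (std_vec (n + 1) r)
      = W n $ r $ 1 * cinner v (std_vec n 1) + W n $ r $ 2 * cinner v (std_vec n 2)}"
  have bl: "bounded_linear A" and AC: "\<And>c x. A (c *\<^sub>C x) = c *\<^sub>C A x"
    and As: "\<And>n k. A (std_vec n k) = W n $ 1 $ k *\<^sub>C std_vec (n + 1) 1 + W n $ 2 $ k *\<^sub>C std_vec (n + 1) 2"
    using assms by (auto simp: block_shift_def bounded_op_def)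
  note lin = bounded_linear.linear[OF bl]
  have "M = UNIV"
  proof (rule closed_csubspace_eq_UNIV)
    show "csubspace M"
      by (auto simp: csubspace_def M_def subspace_def linear_0[OF lin] linear_add[OF lin]
          cinner_add_left AC cinner_scaleC_left algebra_simps simp flip: scaleC_of_real)
    show "closed M" unfolding M_def
      by (intro closed_Collect_eq continuous_intros continuous_on_cinner_left
          linear_continuous_on bl)
    show "std_vec m k \<in> M" for m k
      using exhaust_2[of r] exhaust_2[of k]
      by (auto simp: M_def As cinner_add_left cinner_scaleC_left cinner_std_vec_std_vec)
  qed
  then have "v \<in> M" by blast
  then show ?thesis by (simp add: M_def sum_2)
qed

text \<open>
  The hypotheses isolate what the weights must provide: the trace condition confines the
  non-zero off-diagonal blocks of a commuting projection to one antidiagonal, and the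
  non-commutativity forces its diagonal blocks to be scalar.
\<close>

theorem block_shift_irreducible:
  assumes shift: "block_shift W A"
    and det: "\<And>n. det (W n) = 1"
    and trace: "\<And>n m. n \<noteq> m \<Longrightarrow> trace (adj (W n) ** W n) = trace (adj (W m) ** W m) \<Longrightarrow> m = - (n + i0)"
    and noncomm: "\<And>n. (adj (W (n + 1)) ** W (n + 1)) ** (W n ** adj (W n))
      \<noteq> (W n ** adj (W n)) ** (adj (W (n + 1)) ** W (n + 1))"
  shows "irreducible_op A"
  unfolding irreducible_op_def
proof (intro allI impI)
  fix M assume red: "reducing_subspace A M"
  then have M: "csubspace M" "closed M" by (auto simp: reducing_subspace_def)
  have As: "\<And>n k. A (std_vec n k) = W n $ 1 $ k *\<^sub>C std_vec (n + 1) 1 + W n $ 2 $ k *\<^sub>C std_vec (n + 1) 2"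
    and bA: "bounded_op A"
    using shift by (auto simp: block_shift_def)
  obtain E where EM: "\<And>x. E x \<in> M" and EO: "\<And>x. x - E x \<in> orth_compl M"
    and Eadd: "\<And>x y. E (x + y) = E x + E y" and EC: "\<And>c x. E (c *\<^sub>C x) = c *\<^sub>C E x"
    and EA: "\<And>x. E (A x) = A (E x)" and Eself: "\<And>x y. cinner (E x) y = cinner x (E y)"
    using reducing_subspace_projection[OF red bA] by blast
  define P :: "int \<Rightarrow> int \<Rightarrow> complex^2^2" where
    "P i j = (\<chi> r k. cinner (E (std_vec j k)) (std_vec i r))" for i j
  have PW: "P (i + 1) (j + 1) ** W j = W i ** P i j" for i j
  proof -
    have "(P (i + 1) (j + 1) ** W j) $ r $ k = cinner (E (A (std_vec j k))) (std_vec (i + 1) r)" for r k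
      by (simp add: matrix_matrix_mult_def sum_2 P_def As Eadd EC cinner_add_left cinner_scaleC_left)
    also have "\<dots> r k = (W i ** P i j) $ r $ k" for r k
      unfolding EA block_shift_coord[OF shift] by (simp add: matrix_matrix_mult_def P_def)
    finally show ?thesis by (simp add: vec_eq_iff)
  qed
  have Padj: "adj (P i j) = P j i" for i j
    by (simp add: adj_def P_def vec_eq_iff Eself flip: cinner_commute)
  have WP: "adj (W i) ** P (i + 1) (j + 1) = P i j ** adj (W j)" for i j
    using arg_cong[OF PW[of j i], of adj] by (simp add: adj_mult Padj)
  have PWW: "P i j ** (adj (W j) ** W j) = (adj (W i) ** W i) ** P i j" for i j
    by (metis PW WP matrix_mul_assoc)
  have PWW': "P (i + 1) (j + 1) ** (W j ** adj (W j)) = (W i ** adj (W i)) ** P (i + 1) (j + 1)" for i j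
    by (metis PW WP matrix_mul_assoc)
  have det': "det (adj (W n) ** W n) = 1" for n
    by (simp add: det_mul det_adj_2 det)
  have "\<exists>V. W n ** V = mat 1 \<and> V ** W n = mat 1" for n
    using invertible_det_nz[of "W n"] det[of n] by (auto simp: invertible_def)
  then obtain V where WV: "\<And>n. W n ** V n = mat 1" and VW: "\<And>n. V n ** W n = mat 1" by metis
  have P0: "P i j = 0" if "i \<noteq> j" "j \<noteq> - (i + i0)" for i j
    by (rule intertwiner_eq_0[OF PWW]) (use trace[of i j] that det' in auto)
  have P_off: "P i j = 0" if "i \<noteq> j" for i j
  proof (cases "j = - (i + i0)")
    case True
    \<comment> \<open>\<open>i + j\<close> grows by 2 along the diagonal, so the next pair is off the antidiagonal.\<close>
    then have "P (i + 1) (j + 1) = 0" using that by (intro P0) auto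
    then have "W i ** P i j = 0" using PW[of i j] by simp
    then show ?thesis by (metis VW matrix_mul_assoc matrix_mul_lid times0_right)
  qed (simp add: P0 that)
  have "\<exists>c. P (n + 1) (n + 1) = mat c" for n
    by (rule commutant_scalar[OF PWW PWW' noncomm]) blast
  then have "\<exists>c. P n n = mat c" for n
    by (metis diff_add_cancel)
  then obtain c where c: "\<And>n. P n n = mat (c n)" by metis
  have c_step: "c (n + 1) = c n" for n
  proof -
    have "mat (c (n + 1)) ** W n = mat (c n) ** W n"
      using PW[of n n] by (simp add: c mult_mat_eq)
    then have "mat (c (n + 1)) ** (W n ** V n) = mat (c n) ** (W n ** V n)"
      by (simp add: matrix_mul_assoc)
    then have "mat (c (n + 1)) = (mat (c n) :: complex^2^2)" by (simp add: WV)
    then have "(mat (c (n + 1)) :: complex^2^2) $ 1 $ 1 = (mat (c n) :: complex^2^2) $ 1 $ 1" by simp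
    then show ?thesis by (simp add: mat_def)
  qed
  have c_const: "c n = c 0" for n
    by (induction n rule: int_induct[where k = 0]) (use c_step in \<open>auto, metis diff_add_cancel\<close>)
  have E_std: "E (std_vec n k) = c 0 *\<^sub>C std_vec n k" for n k
  proof -
    have "cinner (E (std_vec n k) - c 0 *\<^sub>C std_vec n k) (std_vec m r) = 0" for m r
    proof -
      have "cinner (E (std_vec n k)) (std_vec m r) = P m n $ r $ k" by (simp add: P_def)
      also have "\<dots> = c 0 * (if n = m \<and> k = r then 1 else 0)"
        using P_off[of m n] c[of n] c_const[of n] by (cases "m = n") (auto simp: mat_def)
      finally show ?thesis
        by (simp add: cinner_diff_left cinner_scaleC_left cinner_std_vec_std_vec)
    qed
    then have "E (std_vec n k) - c 0 *\<^sub>C std_vec n k = 0" by (rule eq_0_if_orthogonal_std_vec)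
    then show ?thesis by simp
  qed
  show "M = {0} \<or> M = UNIV"
  proof (cases "c 0 = 0")
    case True
    have zero: "0 *\<^sub>C x = 0" for x :: "int ell2 \<times> int ell2"
      using scaleC_of_real[of 0 x] by simp
    have "std_vec n k \<in> orth_compl M" for n k
      using EO[of "std_vec n k"] by (simp add: E_std True zero)
    then have "x = 0" if "x \<in> M" for x
      using that by (intro eq_0_if_orthogonal_std_vec) (auto simp: orth_compl_def)
    moreover have "0 \<in> M" using M(1) by (simp add: csubspace_def subspace_0)
    ultimately show ?thesis by blast
  next
    case False
    have one: "1 *\<^sub>C x = x" for x :: "int ell2 \<times> int ell2"
      using scaleC_of_real[of 1 x] by simp
    have "inverse (c 0) *\<^sub>C E (std_vec n k) \<in> M" for n k
      using M(1) EM by (simp add: csubspace_def)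
    then have "std_vec n k \<in> M" for n k
      by (simp add: E_std scaleC_scaleC False one)
    then show ?thesis using closed_csubspace_eq_UNIV[OF M] by blast
  qed
qed

section \<open>The operator matrix\<close>

definition weight_block :: "complex \<Rightarrow> real \<Rightarrow> complex^2^2" where
  "weight_block \<alpha> t = vector [vector [of_real t, \<alpha> * of_real (1 / t - t)], vector [0, of_real (1 / t)]]"

lemma block_shift_T_op:
  assumes "bilateral_weighted_shift (\<lambda>n. complex_of_real (t n)) T0"
    and "bilateral_weighted_shift (\<lambda>n. complex_of_real (1 / t n)) T1"
    and "bounded_op (T_op \<alpha> T0 T1)"
  shows "block_shift (\<lambda>n. weight_block \<alpha> (t n)) (T_op \<alpha> T0 T1)"
proof -
  have T0: "T0 0 = 0" "\<And>c x. T0 (c *\<^sub>C x) = c *\<^sub>C T0 x" "\<And>n. T0 (basis_vec n) = of_real (t n) *\<^sub>C basis_vec (n + 1)"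
   and T1: "T1 0 = 0" "\<And>n. T1 (basis_vec n) = of_real (1 / t n) *\<^sub>C basis_vec (n + 1)"
    using assms(1,2)
    by (auto simp: bilateral_weighted_shift_def bounded_op_def bounded_linear.linear linear_0)
  note coords = zero_ell2.rep_eq plus_ell2.rep_eq minus_ell2.rep_eq scaleC_ell2.rep_eq
  have "T_op \<alpha> T0 T1 (std_vec n k) = weight_block \<alpha> (t n) $ 1 $ k *\<^sub>C std_vec (n + 1) 1
      + weight_block \<alpha> (t n) $ 2 $ k *\<^sub>C std_vec (n + 1) 2" for n k
    using exhaust_2[of k]
    by (auto simp: T_op_def upper_triangular_op_def std_vec_def weight_block_def T0 T1 Let_def
        scaleC_prod_def prod_eq_iff coords algebra_simps intro!: ell2_eqI)
  with assms(3) show ?thesis by (simp add: block_shift_def)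
qed

lemma det_weight_block: "t \<noteq> 0 \<Longrightarrow> det (weight_block \<alpha> t) = 1"
  by (simp add: det_2 weight_block_def)

text \<open>
  The off-diagonal entry contributes \<open>\<bar>\<alpha>\<bar>\<^sup>2 (1/t - t)\<^sup>2\<close>, in which the mixed term is constant; so
  the trace is a strictly increasing affine function of \<open>t\<^sup>2 + 1/t\<^sup>2\<close>.
\<close>

lemma trace_weight_block:
  assumes "t \<noteq> 0"
  shows "trace (adj (weight_block \<alpha> t) ** weight_block \<alpha> t)
    = of_real ((1 + (cmod \<alpha>)\<^sup>2) * (t\<^sup>2 + 1 / t\<^sup>2) - 2 * (cmod \<alpha>)\<^sup>2)"
proof -
  define s where "s = 1 / t"
  have ts: "of_real t * of_real s = (1 :: complex)" using assms by (simp add: s_def flip: of_real_mult)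
  have "trace (adj (weight_block \<alpha> t) ** weight_block \<alpha> t)
    = (of_real t)\<^sup>2 + (of_real s)\<^sup>2 + \<alpha> * cnj \<alpha> * (of_real s - of_real t)\<^sup>2"
    by (simp add: trace_def sum_2 matrix_matrix_mult_def adj_def weight_block_def
        power2_eq_square algebra_simps flip: s_def)
  also have "\<dots> = (1 + \<alpha> * cnj \<alpha>) * ((of_real t)\<^sup>2 + (of_real s)\<^sup>2) - 2 * (\<alpha> * cnj \<alpha>)"
    using ts by algebra
  finally show ?thesis
    by (simp add: s_def power_divide flip: complex_norm_square)
qed

text \<open>
  One of the equations of \<open>commute_2_iff\<close> fails: for \<open>s = 1/t\<close> and \<open>q = 1/p\<close> its two sides differ
  by \<open>\<alpha> (s - t) (q - p) t q (1 + \<bar>\<alpha>\<bar>\<^sup>2) (p\<^sup>2 - s\<^sup>2)\<close>, which is a product of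
  non-zero factors.
\<close>

lemma weight_block_noncommute:
  assumes t: "t > 0" "t \<noteq> 1" and p: "p > 0" "p \<noteq> 1" and pt: "t \<noteq> 1 / p" and \<alpha>: "\<alpha> \<noteq> 0"
  defines "A \<equiv> adj (weight_block \<alpha> t) ** weight_block \<alpha> t"
    and "B \<equiv> weight_block \<alpha> p ** adj (weight_block \<alpha> p)"
  shows "A ** B \<noteq> B ** A"
proof -
  define s q where "s = 1 / t" and "q = 1 / p"
  have ts: "of_real t * of_real s = (1 :: complex)" and pq: "of_real p * of_real q = (1 :: complex)"
    using t p by (simp_all add: s_def q_def flip: of_real_mult)
  define N where "N = \<alpha> * cnj \<alpha>"
  have "(A$1$1 - A$2$2) * B$1$2 - (B$1$1 - B$2$2) * A$1$2
    = ((of_real t)\<^sup>2 - (of_real s)\<^sup>2 - N * (of_real s - of_real t)\<^sup>2) * (\<alpha> * (of_real q - of_real p) * of_real q)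
      - ((of_real p)\<^sup>2 - (of_real q)\<^sup>2 + N * (of_real q - of_real p)\<^sup>2) * (of_real t * \<alpha> * (of_real s - of_real t))"
    by (simp add: A_def B_def sum_2 matrix_matrix_mult_def adj_def weight_block_def N_def
        power2_eq_square algebra_simps flip: s_def q_def)
  also have "\<dots> = \<alpha> * (of_real s - of_real t) * (of_real q - of_real p) * of_real t * of_real q
      * (1 + N) * ((of_real p)\<^sup>2 - (of_real s)\<^sup>2)"
    using ts pq by algebra
  also have "\<dots> = \<alpha> * of_real ((s - t) * (q - p) * t * q * (1 + (cmod \<alpha>)\<^sup>2) * (p\<^sup>2 - s\<^sup>2))"
    by (simp add: N_def flip: complex_norm_square)
  also have "\<dots> \<noteq> 0"
  proof -
    have "s \<noteq> t" "q \<noteq> p"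
      using t p by (auto simp: s_def q_def field_simps power2_eq_square[symmetric] power2_eq_1_iff)
    moreover have "p\<^sup>2 \<noteq> s\<^sup>2"
    proof -
      have "p \<noteq> s" using t p pt by (auto simp: s_def field_simps)
      then show ?thesis using t p by (simp add: s_def power2_eq_iff_nonneg del: power_one_over)
    qed
    moreover have "1 + (cmod \<alpha>)\<^sup>2 \<noteq> 0" by (smt (verit) zero_le_power2)
    moreover have "q \<noteq> 0" using p by (simp add: q_def)
    ultimately show ?thesis using \<alpha> t by (simp only: mult_eq_0_iff of_real_eq_0_iff) auto
  qed
  finally show ?thesis unfolding commute_2_iff by auto
qed

theorem proposition3p1:
  fixes t :: "int \<Rightarrow> real" and \<alpha> :: complex
    and T0 T1 :: "int ell2 \<Rightarrow> int ell2"
  assumes "\<And>n. t n \<noteq> 0"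
    and "bilateral_weighted_shift (\<lambda>n. complex_of_real (t n)) T0"
    and "bilateral_weighted_shift (\<lambda>n. complex_of_real (1 / t n)) T1"
    and "\<alpha> \<noteq> 0"
    and "(\<lambda>x. \<alpha> *\<^sub>C T1 x) \<noteq> (\<lambda>x. T0 (\<alpha> *\<^sub>C x))"
    and "bounded_op (T_op \<alpha> T0 T1)"
    and "\<exists>i0::int. \<forall>n m. n \<noteq> m \<longrightarrow>
           (t n)\<^sup>2 + 1 / (t n)\<^sup>2 = (t m)\<^sup>2 + 1 / (t m)\<^sup>2 \<longrightarrow> m = - (n + i0)"
    and "\<forall>n. t n > 0 \<and> t n \<noteq> 1 / t (n - 1) \<and> 1 / t (n - 1) \<noteq> 1"
  shows "irreducible_op (T_op \<alpha> T0 T1)"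
proof -
  obtain i0 where i0: "\<And>n m. n \<noteq> m \<Longrightarrow>
      (t n)\<^sup>2 + 1 / (t n)\<^sup>2 = (t m)\<^sup>2 + 1 / (t m)\<^sup>2 \<Longrightarrow> m = - (n + i0)"
    using assms(7) by blast
  have pos: "t n > 0" and ne: "t (n + 1) \<noteq> 1 / t n" and ne1: "t n \<noteq> 1" for n
    using assms(8)[rule_format, of n] assms(8)[rule_format, of "n + 1"] by auto
  show ?thesis
  proof (rule block_shift_irreducible[OF block_shift_T_op[OF assms(2,3,6)]])
    show "det (weight_block \<alpha> (t n)) = 1" for n by (rule det_weight_block[OF assms(1)])
    show "m = - (n + i0)"
      if "n \<noteq> m" and eq: "trace (adj (weight_block \<alpha> (t n)) ** weight_block \<alpha> (t n))
        = trace (adj (weight_block \<alpha> (t m)) ** weight_block \<alpha> (t m))" for n m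
    proof (rule i0[OF that(1)])
      have "1 + (cmod \<alpha>)\<^sup>2 \<noteq> 0" by (smt (verit) zero_le_power2)
      moreover have "(1 + (cmod \<alpha>)\<^sup>2) * ((t n)\<^sup>2 + 1 / (t n)\<^sup>2) = (1 + (cmod \<alpha>)\<^sup>2) * ((t m)\<^sup>2 + 1 / (t m)\<^sup>2)"
        using eq unfolding trace_weight_block[OF assms(1)] of_real_eq_iff by linarith
      ultimately show "(t n)\<^sup>2 + 1 / (t n)\<^sup>2 = (t m)\<^sup>2 + 1 / (t m)\<^sup>2"
        unfolding mult_cancel_left by blast
    qed
    show "(adj (weight_block \<alpha> (t (n + 1))) ** weight_block \<alpha> (t (n + 1)))
        ** (weight_block \<alpha> (t n) ** adj (weight_block \<alpha> (t n)))
      \<noteq> (weight_block \<alpha> (t n) ** adj (weight_block \<alpha> (t n)))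
        ** (adj (weight_block \<alpha> (t (n + 1))) ** weight_block \<alpha> (t (n + 1)))" for n
      by (rule weight_block_noncommute) (use pos ne ne1 assms(4) in auto)
  qed
qed

end
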